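(* Let $(\mathcal{M}, g, A)$ be a K\"ahler manifold with a quarter-symmetric metric $A$-connection $\overset{1}{\nabla}_XY=\overset{g}{\nabla}_XY-\pi(X)AY$ with generator $\pi$. (1) If $\overset{g}{\nabla}\pi$ is hybrid, then the curvature tensor of the first kind satisfies, for all vector fields $X,Y,Z,W$, $$\overset{1}{R}(X,Y,AZ,AW)=\overset{1}{R}(AX,AY,Z,W),$$ $$\overset{1}{R}(X,AY,AZ,W)=\overset{1}{R}(AX,Y,Z,AW),$$ $$\overset{1}{R}(AX,AY,AZ,AW)=\overset{1}{R}(X,Y,Z,W).$$ (2) The curvature tensor of the first kind satisfies, for all $X,Y,Z,W$, $$\overset{1}{R}(X,Y)AZ=A\overset{1}{R}(X,Y)Z,\qquad \overset{1}{R}(X,Y,Z,AW)=-\overset{1}{R}(X,Y,AZ,W).$$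
   Context: A K\"ahler manifold $(\mathcal{M},g,A)$ is a Riemannian manifold $(\mathcal{M},g)$ of dimension $n=2k\ge4$ with a $(1,1)$ tensor field $A$ satisfying $A^2=-I$, $g(AX,AY)=g(X,Y)$ and $\overset{g}{\nabla}A=0$, where $\overset{g}{\nabla}$ is the Levi-Civita connection. $\overset{g}{R}$ is the Riemannian curvature tensor of $g$, $\overset{g}{R}(X,Y)Z=\overset{g}{\nabla}_X\overset{g}{\nabla}_YZ-\overset{g}{\nabla}_Y\overset{g}{\nabla}_XZ-\overset{g}{\nabla}_{[X,Y]}Z$. A $(0,2)$ tensor $B$ is hybrid if $B(AX,Y)=-B(X,AY)$ for all $X,Y$; $\overset{g}{\nabla}\pi$ is viewed as the $(0,2)$ tensor $(X,Y)\mapsto(\overset{g}{\nabla}_X\pi)(Y)$. For a 1-form $\pi$, the curvature tensor of the first kind is the curvature tensor of $\overset{1}{\nabla}$, given by $$\overset{1}{R}(X,Y)Z=\overset{g}{R}(X,Y)Z-\overset{1}{D}(X,Y)AZ,\qquad \overset{1}{D}(X,Y)=(\overset{g}{\nabla}_X\pi)(Y)-(\overset{g}{\nabla}_Y\pi)(X),$$ and $\overset{1}{R}(X,Y,Z,W)=g(\overset{1}{R}(X,Y)Z,W)$. *)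

theory Defs
  imports "HOL-Analysis.Analysis" "HOL-Library.Function_Algebras"
begin

section \<open>Smooth manifolds\<close>

text \<open>
  A manifold is a Hausdorff second countable type \<open>'m\<close> with a smooth atlas modelled on a Euclidean
  space \<open>'e\<close>; its dimension is \<open>DIM('e)\<close>.
\<close>

text \<open>
  Only used for open \<open>S\<close>: \<open>f\<close> is of class \<open>C^(k+1)\<close> iff it is differentiable and all its directional
  derivatives are of class \<open>C^k\<close>.
\<close>

fun Ck_on :: "nat \<Rightarrow> ('a::real_normed_vector \<Rightarrow> 'b::real_normed_vector) \<Rightarrow> 'a set \<Rightarrow> bool" where
  "Ck_on 0 f S \<longleftrightarrow> continuous_on S f"
| "Ck_on (Suc k) f S \<longleftrightarrow>
     f differentiable_on S \<and> (\<forall>v. Ck_on k (\<lambda>x. frechet_derivative f (at x) v) S)"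

definition smooth_on :: "('a::real_normed_vector \<Rightarrow> 'b::real_normed_vector) \<Rightarrow> 'a set \<Rightarrow> bool" where
  "smooth_on f S \<longleftrightarrow> (\<forall>k. Ck_on k f S)"

type_synonym ('m, 'e) chart = "'m set \<times> ('m \<Rightarrow> 'e)"

definition is_chart :: "('m::topological_space, 'e::euclidean_space) chart \<Rightarrow> bool" where
  "is_chart = (\<lambda>(U, x). open U \<and> open (x ` U) \<and> homeomorphism U (x ` U) x (inv_into U x))"

definition smooth_atlas :: "('m::{t2_space,second_countable_topology}, 'e::euclidean_space) chart set \<Rightarrow> bool"
  where
  "smooth_atlas M \<longleftrightarrow>
     (\<forall>c\<in>M. is_chart c) \<and>
     (\<Union>(U, x)\<in>M. U) = UNIV \<and>
     (\<forall>(U, x)\<in>M. \<forall>(V, y)\<in>M. smooth_on (y \<circ> inv_into U x) (x ` (U \<inter> V)))"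

definition smooth_functions :: "('m::topological_space, 'e::euclidean_space) chart set \<Rightarrow> ('m \<Rightarrow> real) set"
  where
  "smooth_functions M = {f. \<forall>(U, x)\<in>M. smooth_on (f \<circ> inv_into U x) (x ` U)}"


section \<open>Tangent vectors and vector fields\<close>

text \<open>
  Tangent vectors at \<open>p\<close> are the derivations at \<open>p\<close> of the algebra of smooth functions.
  Since HOL functions are total, a derivation is required to vanish on non-smooth functions, so that
  equality of tangent vectors is plain equality.
  Sums, differences and negatives of tangent vectors and vector fields are the pointwise operations
  of \<^theory>\<open>HOL-Library.Function_Algebras\<close>.
\<close>

type_synonym 'm tangent_vector = "('m \<Rightarrow> real) \<Rightarrow> real"
type_synonym 'm vector_field = "'m \<Rightarrow> 'm tangent_vector"

definition scale_tv :: "real \<Rightarrow> 'm tangent_vector \<Rightarrow> 'm tangent_vector" where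
  "scale_tv c v = (\<lambda>f. c * v f)"

definition tangent_space ::
  "('m::topological_space, 'e::euclidean_space) chart set \<Rightarrow> 'm \<Rightarrow> 'm tangent_vector set" where
  "tangent_space M p = {v.
     (\<forall>f\<in>smooth_functions M. \<forall>h\<in>smooth_functions M. v (f + h) = v f + v h) \<and>
     (\<forall>c. \<forall>f\<in>smooth_functions M. v (\<lambda>q. c * f q) = c * v f) \<and>
     (\<forall>f\<in>smooth_functions M. \<forall>h\<in>smooth_functions M. v (f * h) = f p * v h + h p * v f) \<and>
     (\<forall>f. f \<notin> smooth_functions M \<longrightarrow> v f = 0)}"

definition deriv_along :: "'m vector_field \<Rightarrow> ('m \<Rightarrow> real) \<Rightarrow> 'm \<Rightarrow> real" where
  "deriv_along X f = (\<lambda>p. X p f)"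

definition vector_fields :: "('m::topological_space, 'e::euclidean_space) chart set \<Rightarrow> 'm vector_field set"
  where
  "vector_fields M = {X. (\<forall>p. X p \<in> tangent_space M p) \<and>
     (\<forall>f\<in>smooth_functions M. deriv_along X f \<in> smooth_functions M)}"

definition scale_vf :: "('m \<Rightarrow> real) \<Rightarrow> 'm vector_field \<Rightarrow> 'm vector_field" where
  "scale_vf f X = (\<lambda>p. scale_tv (f p) (X p))"

definition lie_bracket :: "'m vector_field \<Rightarrow> 'm vector_field \<Rightarrow> 'm vector_field" where
  "lie_bracket X Y = (\<lambda>p f. X p (deriv_along Y f) - Y p (deriv_along X f))"


section \<open>Tensor fields\<close>

type_synonym 'm one_form = "'m \<Rightarrow> 'm tangent_vector \<Rightarrow> real"
type_synonym 'm bilinear_form = "'m \<Rightarrow> 'm tangent_vector \<Rightarrow> 'm tangent_vector \<Rightarrow> real"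
type_synonym 'm endo_field = "'m \<Rightarrow> 'm tangent_vector \<Rightarrow> 'm tangent_vector"

definition form_app :: "'m one_form \<Rightarrow> 'm vector_field \<Rightarrow> 'm \<Rightarrow> real" where
  "form_app \<pi> X = (\<lambda>p. \<pi> p (X p))"

definition bil_app :: "'m bilinear_form \<Rightarrow> 'm vector_field \<Rightarrow> 'm vector_field \<Rightarrow> 'm \<Rightarrow> real" where
  "bil_app g X Y = (\<lambda>p. g p (X p) (Y p))"

definition endo_app :: "'m endo_field \<Rightarrow> 'm vector_field \<Rightarrow> 'm vector_field" where
  "endo_app A X = (\<lambda>p. A p (X p))"

definition smooth_one_form ::
  "('m::topological_space, 'e::euclidean_space) chart set \<Rightarrow> 'm one_form \<Rightarrow> bool" where
  "smooth_one_form M \<pi> \<longleftrightarrow>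
     (\<forall>p. \<forall>u\<in>tangent_space M p. \<forall>v\<in>tangent_space M p. \<pi> p (u + v) = \<pi> p u + \<pi> p v) \<and>
     (\<forall>p c. \<forall>u\<in>tangent_space M p. \<pi> p (scale_tv c u) = c * \<pi> p u) \<and>
     (\<forall>X\<in>vector_fields M. form_app \<pi> X \<in> smooth_functions M)"

definition smooth_endo_field ::
  "('m::topological_space, 'e::euclidean_space) chart set \<Rightarrow> 'm endo_field \<Rightarrow> bool" where
  "smooth_endo_field M A \<longleftrightarrow>
     (\<forall>p. \<forall>u\<in>tangent_space M p. A p u \<in> tangent_space M p) \<and>
     (\<forall>p. \<forall>u\<in>tangent_space M p. \<forall>v\<in>tangent_space M p. A p (u + v) = A p u + A p v) \<and>
     (\<forall>p c. \<forall>u\<in>tangent_space M p. A p (scale_tv c u) = scale_tv c (A p u)) \<and>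
     (\<forall>X\<in>vector_fields M. endo_app A X \<in> vector_fields M)"

definition riemannian_metric ::
  "('m::topological_space, 'e::euclidean_space) chart set \<Rightarrow> 'm bilinear_form \<Rightarrow> bool" where
  "riemannian_metric M g \<longleftrightarrow>
     (\<forall>p. \<forall>u\<in>tangent_space M p. \<forall>v\<in>tangent_space M p. g p u v = g p v u) \<and>
     (\<forall>p. \<forall>u\<in>tangent_space M p. \<forall>v\<in>tangent_space M p. \<forall>w\<in>tangent_space M p.
        g p (u + v) w = g p u w + g p v w) \<and>
     (\<forall>p c. \<forall>u\<in>tangent_space M p. \<forall>v\<in>tangent_space M p. g p (scale_tv c u) v = c * g p u v) \<and>
     (\<forall>p. \<forall>u\<in>tangent_space M p. u \<noteq> 0 \<longrightarrow> g p u u > 0) \<and>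
     (\<forall>X\<in>vector_fields M. \<forall>Y\<in>vector_fields M. bil_app g X Y \<in> smooth_functions M)"


section \<open>Connections\<close>

type_synonym 'm connection = "'m vector_field \<Rightarrow> 'm vector_field \<Rightarrow> 'm vector_field"

text \<open>Only the values of a connection on smooth vector fields are constrained.\<close>

definition affine_connection ::
  "('m::topological_space, 'e::euclidean_space) chart set \<Rightarrow> 'm connection \<Rightarrow> bool" where
  "affine_connection M D \<longleftrightarrow>
     (\<forall>X\<in>vector_fields M. \<forall>Y\<in>vector_fields M. D X Y \<in> vector_fields M) \<and>
     (\<forall>X\<in>vector_fields M. \<forall>X'\<in>vector_fields M. \<forall>Y\<in>vector_fields M. D (X + X') Y = D X Y + D X' Y) \<and>
     (\<forall>f\<in>smooth_functions M. \<forall>X\<in>vector_fields M. \<forall>Y\<in>vector_fields M.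
        D (scale_vf f X) Y = scale_vf f (D X Y)) \<and>
     (\<forall>X\<in>vector_fields M. \<forall>Y\<in>vector_fields M. \<forall>Y'\<in>vector_fields M. D X (Y + Y') = D X Y + D X Y') \<and>
     (\<forall>f\<in>smooth_functions M. \<forall>X\<in>vector_fields M. \<forall>Y\<in>vector_fields M.
        D X (scale_vf f Y) = scale_vf (deriv_along X f) Y + scale_vf f (D X Y))"

definition torsion :: "'m connection \<Rightarrow> 'm vector_field \<Rightarrow> 'm vector_field \<Rightarrow> 'm vector_field" where
  "torsion D X Y = D X Y - D Y X - lie_bracket X Y"

definition curvature ::
  "'m connection \<Rightarrow> 'm vector_field \<Rightarrow> 'm vector_field \<Rightarrow> 'm vector_field \<Rightarrow> 'm vector_field" where
  "curvature D X Y Z = D X (D Y Z) - D Y (D X Z) - D (lie_bracket X Y) Z"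

definition cov_deriv_form ::
  "'m connection \<Rightarrow> 'm one_form \<Rightarrow> 'm vector_field \<Rightarrow> 'm vector_field \<Rightarrow> 'm \<Rightarrow> real" where
  "cov_deriv_form D \<pi> X Y = deriv_along X (form_app \<pi> Y) - form_app \<pi> (D X Y)"

definition cov_deriv_bil ::
  "'m connection \<Rightarrow> 'm bilinear_form \<Rightarrow> 'm vector_field \<Rightarrow> 'm vector_field \<Rightarrow> 'm vector_field \<Rightarrow> 'm \<Rightarrow> real"
  where
  "cov_deriv_bil D g X Y Z =
     deriv_along X (bil_app g Y Z) - bil_app g (D X Y) Z - bil_app g Y (D X Z)"

definition cov_deriv_endo ::
  "'m connection \<Rightarrow> 'm endo_field \<Rightarrow> 'm vector_field \<Rightarrow> 'm vector_field \<Rightarrow> 'm vector_field" where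
  "cov_deriv_endo D A X Y = D X (endo_app A Y) - endo_app A (D X Y)"

definition levi_civita_connection ::
  "('m::topological_space, 'e::euclidean_space) chart set \<Rightarrow> 'm bilinear_form \<Rightarrow> 'm connection \<Rightarrow> bool"
  where
  "levi_civita_connection M g D \<longleftrightarrow>
     affine_connection M D \<and>
     (\<forall>X\<in>vector_fields M. \<forall>Y\<in>vector_fields M. torsion D X Y = 0) \<and>
     (\<forall>X\<in>vector_fields M. \<forall>Y\<in>vector_fields M. \<forall>Z\<in>vector_fields M. cov_deriv_bil D g X Y Z = 0)"


section \<open>Kaehler manifolds\<close>

text \<open>The argument \<open>D\<close> is the (uniquely determined) Levi-Civita connection of \<open>g\<close>.\<close>

definition kaehler_manifold ::
  "('m::{t2_space,second_countable_topology}, 'e::euclidean_space) chart set \<Rightarrow>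
     'm bilinear_form \<Rightarrow> 'm endo_field \<Rightarrow> 'm connection \<Rightarrow> bool" where
  "kaehler_manifold M g A D \<longleftrightarrow>
     smooth_atlas M \<and> even DIM('e) \<and> DIM('e) \<ge> 4 \<and>
     riemannian_metric M g \<and> smooth_endo_field M A \<and> levi_civita_connection M g D \<and>
     (\<forall>p. \<forall>u\<in>tangent_space M p. A p (A p u) = - u) \<and>
     (\<forall>p. \<forall>u\<in>tangent_space M p. \<forall>v\<in>tangent_space M p. g p (A p u) (A p v) = g p u v) \<and>
     (\<forall>X\<in>vector_fields M. \<forall>Y\<in>vector_fields M. cov_deriv_endo D A X Y = 0)"

definition hybrid ::
  "('m::topological_space, 'e::euclidean_space) chart set \<Rightarrow> 'm endo_field \<Rightarrow>
     ('m vector_field \<Rightarrow> 'm vector_field \<Rightarrow> 'm \<Rightarrow> real) \<Rightarrow> bool" where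
  "hybrid M A B \<longleftrightarrow>
     (\<forall>X\<in>vector_fields M. \<forall>Y\<in>vector_fields M. B (endo_app A X) Y = - B X (endo_app A Y))"

definition quarter_symmetric_connection ::
  "'m connection \<Rightarrow> 'm endo_field \<Rightarrow> 'm one_form \<Rightarrow> 'm connection" where
  "quarter_symmetric_connection D A \<pi> X Y = D X Y - scale_vf (form_app \<pi> X) (endo_app A Y)"

text \<open>
  The curvature tensor of the first kind is the curvature of the quarter-symmetric connection. On a
  Kaehler manifold it equals \<open>R(X,Y)Z - (N X Y - N Y X) A Z\<close>, where \<open>R\<close> is the curvature of \<open>D\<close> and
  \<open>N = cov_deriv_form D \<pi>\<close>.
\<close>

definition curvature1 ::
  "'m connection \<Rightarrow> 'm endo_field \<Rightarrow> 'm one_form \<Rightarrow>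
     'm vector_field \<Rightarrow> 'm vector_field \<Rightarrow> 'm vector_field \<Rightarrow> 'm vector_field" where
  "curvature1 D A \<pi> = curvature (quarter_symmetric_connection D A \<pi>)"

definition curvature1_low ::
  "'m bilinear_form \<Rightarrow> 'm connection \<Rightarrow> 'm endo_field \<Rightarrow> 'm one_form \<Rightarrow>
     'm vector_field \<Rightarrow> 'm vector_field \<Rightarrow> 'm vector_field \<Rightarrow> 'm vector_field \<Rightarrow> 'm \<Rightarrow> real" where
  "curvature1_low g D A \<pi> X Y Z W = bil_app g (curvature1 D A \<pi> X Y Z) W"

end

theory Submission
  imports Defs
begin

text \<open>
  Since \<open>J\<close> is parallel and \<open>J\<^sup>2 = -1\<close>, the terms \<open>\<pi>(X) \<pi>(Y) J\<^sup>2 Z\<close> in the curvature of the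
  quarter-symmetric connection cancel, which leaves \<open>R(X,Y)Z - d\<pi>(X,Y) J Z\<close>. This commutes with \<open>J\<close>
  in \<open>Z\<close>, and \<open>J\<close> is skew for \<open>g\<close>, whence part (2). For part (1), pair symmetry makes \<open>R\<close> invariant under
  \<open>J\<close> acting on the first two arguments, and hybridity of the covariant derivative of \<open>\<pi>\<close> does the
  same for \<open>d\<pi>\<close>.
\<close>

section \<open>Smooth functions\<close>

lemma has_derivative_open_cong:
  assumes "open S" "x \<in> S" "\<And>y. y \<in> S \<Longrightarrow> f y = h y"
  shows "(f has_derivative F) (at x) \<longleftrightarrow> (h has_derivative F) (at x)"
  using assms has_derivative_transform_within_open[of f F x UNIV S h]
    has_derivative_transform_within_open[of h F x UNIV S f] by auto

lemma frechet_derivative_open_cong: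
  assumes "open S" "x \<in> S" "\<And>y. y \<in> S \<Longrightarrow> f y = h y"
  shows "frechet_derivative f (at x) = frechet_derivative h (at x)"
  unfolding frechet_derivative_def using has_derivative_open_cong[OF assms] by simp

text \<open>Derivatives at a point of an open set only see values in that set. This matters because
  the sum and product rules below compute \<open>frechet_derivative\<close> only at points of
  \<open>S\<close>, while \<open>Ck_on\<close> speaks of the total function.\<close>

lemma Ck_on_cong:
  assumes "open S" "\<And>y. y \<in> S \<Longrightarrow> f y = h y"
  shows "Ck_on k f S \<longleftrightarrow> Ck_on k h S"
  using assms(2)
proof (induction k arbitrary: f h)
  case 0
  then show ?case by (simp cong: continuous_on_cong)
next
  case (Suc k)
  have "f differentiable_on S \<longleftrightarrow> h differentiable_on S"
    using has_derivative_open_cong[OF assms(1) _ Suc.prems]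
    by (simp add: differentiable_on_eq_differentiable_at[OF assms(1)] differentiable_def)
  moreover have "Ck_on k (\<lambda>x. frechet_derivative f (at x) v) S \<longleftrightarrow>
      Ck_on k (\<lambda>x. frechet_derivative h (at x) v) S" for v
    using frechet_derivative_open_cong[OF assms(1) _ Suc.prems] by (intro Suc.IH) simp
  ultimately show ?case by simp
qed

text \<open>In the Leibniz rule one factor stays undifferentiated, so its regularity has to be
  lowered by one before the induction hypothesis applies.\<close>

lemma Ck_on_SucD: "Ck_on (Suc k) f S \<Longrightarrow> Ck_on k f S"
proof (induction k arbitrary: f)
  case 0
  then show ?case by (simp add: differentiable_imp_continuous_on)
next
  case (Suc k)
  then show ?case by (metis Ck_on.simps(2))
qed

lemma Ck_on_const: "Ck_on k (\<lambda>x. c) S"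
  by (induction k arbitrary: c) (simp_all add: frechet_derivative_const)

lemma Ck_on_add:
  assumes "open S" "Ck_on k f S" "Ck_on k h S"
  shows "Ck_on k (\<lambda>x. f x + h x) S"
  using assms(2,3)
proof (induction k arbitrary: f h)
  case 0
  then show ?case by (simp add: continuous_on_add)
next
  case (Suc k)
  have d: "f differentiable at x" "h differentiable at x" if "x \<in> S" for x
    using Suc.prems that by (auto simp: differentiable_on_eq_differentiable_at[OF assms(1)])
  have "frechet_derivative (\<lambda>x. f x + h x) (at x) v =
      frechet_derivative f (at x) v + frechet_derivative h (at x) v" if "x \<in> S" for x v
    using has_derivative_add[OF d(1)[OF that, unfolded frechet_derivative_works]
        d(2)[OF that, unfolded frechet_derivative_works]]
    by (simp add: frechet_derivative_at[symmetric])
  then have "Ck_on k (\<lambda>x. frechet_derivative (\<lambda>x. f x + h x) (at x) v) S" for v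
    using Suc by (subst Ck_on_cong[OF assms(1)]) auto
  then show ?case using Suc.prems by (simp add: differentiable_on_add)
qed

lemma Ck_on_mult:
  fixes f h :: "'a::real_normed_vector \<Rightarrow> 'b::real_normed_algebra"
  assumes "open S" "Ck_on k f S" "Ck_on k h S"
  shows "Ck_on k (\<lambda>x. f x * h x) S"
  using assms(2,3)
proof (induction k arbitrary: f h)
  case 0
  then show ?case by (simp add: continuous_on_mult)
next
  case (Suc k)
  have d: "f differentiable at x" "h differentiable at x" if "x \<in> S" for x
    using Suc.prems that by (auto simp: differentiable_on_eq_differentiable_at[OF assms(1)])
  have "frechet_derivative (\<lambda>x. f x * h x) (at x) v =
      f x * frechet_derivative h (at x) v + frechet_derivative f (at x) v * h x" if "x \<in> S" for x v
    using has_derivative_mult[OF d(1)[OF that, unfolded frechet_derivative_works]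
        d(2)[OF that, unfolded frechet_derivative_works]]
    by (simp add: frechet_derivative_at[symmetric])
  moreover have "Ck_on k (\<lambda>x. f x * frechet_derivative h (at x) v + frechet_derivative f (at x) v * h x) S" for v
    using Suc.prems Suc.prems[THEN Ck_on_SucD] by (intro Ck_on_add[OF assms(1)] Suc.IH) auto
  ultimately have "Ck_on k (\<lambda>x. frechet_derivative (\<lambda>x. f x * h x) (at x) v) S" for v
    by (subst Ck_on_cong[OF assms(1)]) auto
  then show ?case using Suc.prems d
    by (auto simp: differentiable_on_eq_differentiable_at[OF assms(1)] differentiable_mult)
qed

locale smooth_manifold =
  fixes M :: "('m::{t2_space,second_countable_topology}, 'e::euclidean_space) chart set"
  assumes atlas: "smooth_atlas M"
begin

abbreviation "SF \<equiv> smooth_functions M"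
abbreviation "VF \<equiv> vector_fields M"

lemma open_chart_image: "(U, x) \<in> M \<Longrightarrow> open (x ` U)"
  using atlas by (fastforce simp: smooth_atlas_def is_chart_def)

lemma smooth_const: "(\<lambda>q. c) \<in> SF"
  by (auto simp: smooth_functions_def smooth_on_def o_def Ck_on_const)

lemma smooth_zero: "0 \<in> SF"
  using smooth_const[of 0] by (simp add: zero_fun_def)

lemma smooth_add: "f \<in> SF \<Longrightarrow> h \<in> SF \<Longrightarrow> f + h \<in> SF"
  unfolding smooth_functions_def smooth_on_def o_def plus_fun_def
  using Ck_on_add[OF open_chart_image] by fast

lemma smooth_mult: "f \<in> SF \<Longrightarrow> h \<in> SF \<Longrightarrow> f * h \<in> SF"
  unfolding smooth_functions_def smooth_on_def o_def times_fun_def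
  using Ck_on_mult[OF open_chart_image] by fast

lemma smooth_minus: "f \<in> SF \<Longrightarrow> - f \<in> SF"
  using smooth_mult[OF smooth_const[of "-1"]] by (simp add: times_fun_def fun_Compl_def)

lemma smooth_diff: "f \<in> SF \<Longrightarrow> h \<in> SF \<Longrightarrow> f - h \<in> SF"
  using smooth_add[OF _ smooth_minus] by fastforce

section \<open>Vector fields\<close>

lemma tangent_add: "u \<in> tangent_space M p \<Longrightarrow> v \<in> tangent_space M p \<Longrightarrow> u + v \<in> tangent_space M p"
  unfolding tangent_space_def by (auto simp: algebra_simps)

lemma tangent_scale: "u \<in> tangent_space M p \<Longrightarrow> scale_tv c u \<in> tangent_space M p"
  unfolding tangent_space_def scale_tv_def by (auto simp: algebra_simps)

lemma scale_tv_minus_one: "scale_tv (- 1) u = - u"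
  by (auto simp: scale_tv_def)

lemma VF_tangent: "X \<in> VF \<Longrightarrow> X p \<in> tangent_space M p"
  by (simp add: vector_fields_def)

lemma VF_deriv: "X \<in> VF \<Longrightarrow> f \<in> SF \<Longrightarrow> deriv_along X f \<in> SF"
  by (simp add: vector_fields_def)

lemma VF_add: "X \<in> VF \<Longrightarrow> Y \<in> VF \<Longrightarrow> X + Y \<in> VF"
proof -
  assume *: "X \<in> VF" "Y \<in> VF"
  have "deriv_along (X + Y) f = deriv_along X f + deriv_along Y f" for f
    by (auto simp: deriv_along_def)
  then show ?thesis using * smooth_add tangent_add by (auto simp: vector_fields_def)
qed

lemma VF_scale: "f \<in> SF \<Longrightarrow> X \<in> VF \<Longrightarrow> scale_vf f X \<in> VF"
proof -
  assume *: "f \<in> SF" "X \<in> VF"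
  have "deriv_along (scale_vf f X) h = f * deriv_along X h" for h
    by (auto simp: deriv_along_def scale_vf_def scale_tv_def)
  then show ?thesis using * smooth_mult tangent_scale
    by (auto simp: vector_fields_def scale_vf_def[of f X])
qed

text \<open>With negation seen as multiplication by a constant function, the module laws supply the
  rules for negatives.\<close>

lemma scale_vf_minus_one: "scale_vf (\<lambda>q. - 1) X = - X"
  by (auto simp: scale_vf_def scale_tv_minus_one)

lemma VF_zero: "0 \<in> VF"
  by (simp add: vector_fields_def tangent_space_def deriv_along_def zero_fun_def[symmetric] smooth_zero)

lemma VF_minus: "X \<in> VF \<Longrightarrow> - X \<in> VF"
  using VF_scale[OF smooth_const[of "-1"]] by (simp add: scale_vf_minus_one)

lemma VF_diff: "X \<in> VF \<Longrightarrow> Y \<in> VF \<Longrightarrow> X - Y \<in> VF"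
  using VF_add[OF _ VF_minus] by fastforce

lemma VF_apply_diff:
  assumes X: "X \<in> VF" and "f \<in> SF" "h \<in> SF"
  shows "X p (f - h) = X p f - X p h"
proof -
  have "X p (f - h + h) = X p (f - h) + X p h"
    using VF_tangent[OF X, of p] assms(2,3) smooth_diff unfolding tangent_space_def by blast
  then show ?thesis by simp
qed

lemma deriv_along_diff:
  "X \<in> VF \<Longrightarrow> f \<in> SF \<Longrightarrow> h \<in> SF \<Longrightarrow> deriv_along X (f - h) = deriv_along X f - deriv_along X h"
  by (auto simp: deriv_along_def VF_apply_diff)

lemma deriv_along_minus: "X \<in> VF \<Longrightarrow> f \<in> SF \<Longrightarrow> deriv_along X (- f) = - deriv_along X f"
  \<comment> \<open>The first instance shows that the derivative of \<open>f - f = 0\<close>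
    vanishes, the second is the difference rule for \<open>0 - f\<close>.\<close>
  using deriv_along_diff[of X f f] deriv_along_diff[of X "f - f" f] smooth_zero by simp

lemma deriv_along_minus_left: "deriv_along (- X) f = - deriv_along X f"
  by (auto simp: deriv_along_def)

lemma deriv_along_add:
  "X \<in> VF \<Longrightarrow> f \<in> SF \<Longrightarrow> h \<in> SF \<Longrightarrow> deriv_along X (f + h) = deriv_along X f + deriv_along X h"
  using VF_tangent[of X] by (fastforce simp: deriv_along_def tangent_space_def)

section \<open>Lie brackets and the Jacobi identity\<close>

lemma deriv_along_lie_bracket:
  "deriv_along (lie_bracket X Y) f = deriv_along X (deriv_along Y f) - deriv_along Y (deriv_along X f)"
  by (auto simp: deriv_along_def lie_bracket_def)

lemma VF_apply_nonsmooth: "X \<in> VF \<Longrightarrow> f \<notin> SF \<Longrightarrow> X p f = 0"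
  using VF_tangent[of X p] by (auto simp: tangent_space_def)

lemma VF_apply_zero: "X \<in> VF \<Longrightarrow> X p 0 = 0"
  using VF_apply_diff[OF _ smooth_zero smooth_zero] by simp

text \<open>On smooth functions every nested bracket expands into triple derivatives, which cancel
  in the cyclic sum. Equality of vector fields is equality on all functions, so the non-smooth ones
  need their own case.\<close>

lemma jacobi:
  assumes V: "X \<in> VF" "Y \<in> VF" "Z \<in> VF"
  shows "lie_bracket X (lie_bracket Y Z) + lie_bracket Y (lie_bracket Z X) + lie_bracket Z (lie_bracket X Y) = 0"
proof (intro ext)
  fix p f
  show "(lie_bracket X (lie_bracket Y Z) + lie_bracket Y (lie_bracket Z X) + lie_bracket Z (lie_bracket X Y)) p f = 0 p f"
  proof (cases "f \<in> SF")
    case True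
    then show ?thesis using V
      by (simp add: lie_bracket_def[of _ "lie_bracket _ _"] deriv_along_lie_bracket VF_apply_diff VF_deriv)
        (simp add: lie_bracket_def)
  next
    \<comment> \<open>Tangent vectors vanish on non-smooth functions, so all first derivatives of
      \<open>f\<close> are the zero function, and the brackets give 0 as well.\<close>
    case False
    then have "deriv_along X f = 0" "deriv_along Y f = 0" "deriv_along Z f = 0"
      using V by (auto simp: deriv_along_def VF_apply_nonsmooth)
    then show ?thesis using V
      by (simp add: lie_bracket_def[of _ "lie_bracket _ _"] deriv_along_lie_bracket VF_apply_zero)
        (simp add: lie_bracket_def deriv_along_def zero_fun_def[symmetric] VF_apply_zero)
  qed
qed

lemma lie_bracket_antisym: "lie_bracket X Y = - lie_bracket Y X"
  by (simp add: fun_eq_iff lie_bracket_def)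

lemma scale_vf_add: "scale_vf f (X + Y) = scale_vf f X + scale_vf f Y"
  by (simp add: fun_eq_iff scale_vf_def scale_tv_def algebra_simps)

lemma scale_vf_diff: "scale_vf f (X - Y) = scale_vf f X - scale_vf f Y"
  by (simp add: fun_eq_iff scale_vf_def scale_tv_def algebra_simps)

lemma scale_vf_minus: "scale_vf f (- X) = - scale_vf f X"
  by (simp add: fun_eq_iff scale_vf_def scale_tv_def algebra_simps)

lemma scale_vf_diff_left: "scale_vf (f - h) X = scale_vf f X - scale_vf h X"
  by (simp add: fun_eq_iff scale_vf_def scale_tv_def algebra_simps)

lemma scale_vf_commute: "scale_vf f (scale_vf h X) = scale_vf h (scale_vf f X)"
  by (simp add: fun_eq_iff scale_vf_def scale_tv_def algebra_simps)

end

section \<open>The Riemann curvature tensor\<close>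

locale riemannian_manifold = smooth_manifold M
  for M :: "('m::{t2_space,second_countable_topology}, 'e::euclidean_space) chart set" +
  fixes g :: "'m bilinear_form" and D :: "'m connection"
  assumes metric: "riemannian_metric M g"
    and levi_civita: "levi_civita_connection M g D"
begin

lemma affine: "affine_connection M D"
  using levi_civita by (simp add: levi_civita_connection_def)

lemma D_VF: "X \<in> VF \<Longrightarrow> Y \<in> VF \<Longrightarrow> D X Y \<in> VF"
  using affine by (simp add: affine_connection_def)

lemma D_add: "X \<in> VF \<Longrightarrow> Y \<in> VF \<Longrightarrow> Y' \<in> VF \<Longrightarrow> D X (Y + Y') = D X Y + D X Y'"
  using affine by (simp add: affine_connection_def)

lemma D_scale_left: "f \<in> SF \<Longrightarrow> X \<in> VF \<Longrightarrow> Y \<in> VF \<Longrightarrow> D (scale_vf f X) Y = scale_vf f (D X Y)"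
  using affine by (simp add: affine_connection_def)

lemma D_scale: "f \<in> SF \<Longrightarrow> X \<in> VF \<Longrightarrow> Y \<in> VF \<Longrightarrow>
    D X (scale_vf f Y) = scale_vf (deriv_along X f) Y + scale_vf f (D X Y)"
  using affine by (simp add: affine_connection_def)

lemma D_diff: "X \<in> VF \<Longrightarrow> Y \<in> VF \<Longrightarrow> Y' \<in> VF \<Longrightarrow> D X (Y - Y') = D X Y - D X Y'"
  using D_add[of X "Y - Y'" Y'] VF_diff by (simp add: algebra_simps)

lemma D_minus: "X \<in> VF \<Longrightarrow> Y \<in> VF \<Longrightarrow> D X (- Y) = - D X Y"
  using D_diff[of X Y Y] D_diff[of X "Y - Y" Y] VF_zero by simp

lemma D_minus_left: "X \<in> VF \<Longrightarrow> Y \<in> VF \<Longrightarrow> D (- X) Y = - D X Y"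
  using D_scale_left[OF smooth_const[of "- 1"]] by (simp add: scale_vf_minus_one)

lemma lie_bracket_eq: "X \<in> VF \<Longrightarrow> Y \<in> VF \<Longrightarrow> lie_bracket X Y = D X Y - D Y X"
  using levi_civita by (simp add: levi_civita_connection_def torsion_def)

text \<open>Vanishing torsion writes the bracket as a difference of covariant derivatives, so
  closure comes from the connection and no Leibniz rule for brackets has to be checked.\<close>

lemma lie_bracket_VF: "X \<in> VF \<Longrightarrow> Y \<in> VF \<Longrightarrow> lie_bracket X Y \<in> VF"
  by (simp add: lie_bracket_eq D_VF VF_diff)

lemma curvature_VF:
  "X \<in> VF \<Longrightarrow> Y \<in> VF \<Longrightarrow> Z \<in> VF \<Longrightarrow> curvature D X Y Z \<in> VF"
  by (simp add: curvature_def D_VF VF_diff lie_bracket_VF)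

lemma curvature_antisym:
  "X \<in> VF \<Longrightarrow> Y \<in> VF \<Longrightarrow> Z \<in> VF \<Longrightarrow> curvature D Y X Z = - curvature D X Y Z"
  using D_minus_left[OF lie_bracket_VF, of X Y Z]
  by (simp add: curvature_def lie_bracket_antisym[of Y X])

text \<open>Vanishing torsion, used for the inner and the outer bracket, turns each nested bracket
  into second covariant derivatives. Their cyclic sum regroups into the cyclic sum of curvatures,
  and the Jacobi identity finishes.\<close>

lemma first_bianchi:
  assumes V: "X \<in> VF" "Y \<in> VF" "Z \<in> VF"
  shows "curvature D X Y Z + curvature D Y Z X + curvature D Z X Y = 0"
proof -
  have "lie_bracket X (lie_bracket Y Z) = D X (D Y Z) - D X (D Z Y) - D (lie_bracket Y Z) X"
    if "X \<in> VF" "Y \<in> VF" "Z \<in> VF" for X Y Z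
  proof -
    have "lie_bracket X (lie_bracket Y Z) = D X (lie_bracket Y Z) - D (lie_bracket Y Z) X"
      using that lie_bracket_eq lie_bracket_VF by blast
    also have "D X (lie_bracket Y Z) = D X (D Y Z) - D X (D Z Y)"
      using that by (simp add: lie_bracket_eq D_diff D_VF)
    finally show ?thesis .
  qed
  from this[of X Y Z] this[of Y Z X] this[of Z X Y]
  have "curvature D X Y Z + curvature D Y Z X + curvature D Z X Y =
      lie_bracket X (lie_bracket Y Z) + lie_bracket Y (lie_bracket Z X) + lie_bracket Z (lie_bracket X Y)"
    using V by (simp add: curvature_def)
  then show ?thesis by (simp add: jacobi[OF V])
qed

section \<open>Metric compatibility and the symmetries of the curvature\<close>

lemma metric_sym: "X \<in> VF \<Longrightarrow> Y \<in> VF \<Longrightarrow> bil_app g X Y = bil_app g Y X"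
  using metric VF_tangent by (fastforce simp: riemannian_metric_def bil_app_def)

lemma metric_add: "X \<in> VF \<Longrightarrow> Y \<in> VF \<Longrightarrow> Z \<in> VF \<Longrightarrow> bil_app g (X + Y) Z = bil_app g X Z + bil_app g Y Z"
  using metric VF_tangent by (fastforce simp: riemannian_metric_def bil_app_def)

lemma metric_scale: "X \<in> VF \<Longrightarrow> Y \<in> VF \<Longrightarrow> bil_app g (scale_vf f X) Y = f * bil_app g X Y"
  using metric VF_tangent by (fastforce simp: riemannian_metric_def bil_app_def scale_vf_def)

lemma metric_diff: "X \<in> VF \<Longrightarrow> Y \<in> VF \<Longrightarrow> Z \<in> VF \<Longrightarrow> bil_app g (X - Y) Z = bil_app g X Z - bil_app g Y Z"
  using metric_add[of "X - Y" Y Z] VF_diff by (simp add: algebra_simps)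

lemma metric_zero: "Y \<in> VF \<Longrightarrow> bil_app g 0 Y = 0"
  using metric_diff[of Y Y Y] by simp

lemma metric_minus: "X \<in> VF \<Longrightarrow> Y \<in> VF \<Longrightarrow> bil_app g (- X) Y = - bil_app g X Y"
  using metric_diff[of 0 X Y] by (simp add: VF_zero metric_zero)

lemma metric_SF: "X \<in> VF \<Longrightarrow> Y \<in> VF \<Longrightarrow> bil_app g X Y \<in> SF"
  using metric by (simp add: riemannian_metric_def)

lemma metric_compat: "X \<in> VF \<Longrightarrow> Y \<in> VF \<Longrightarrow> Z \<in> VF \<Longrightarrow>
    deriv_along X (bil_app g Y Z) = bil_app g (D X Y) Z + bil_app g Y (D X Z)"
  using levi_civita by (simp add: levi_civita_connection_def cov_deriv_bil_def algebra_simps)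

text \<open>The commutator identity for derivatives is applied to the function \<open>g(Z, W)\<close>.\<close>

lemma curvature_skew:
  assumes V: "X \<in> VF" "Y \<in> VF" "Z \<in> VF" "W \<in> VF"
  shows "bil_app g (curvature D X Y Z) W = - bil_app g (curvature D X Y W) Z"
proof -
  have 2: "deriv_along X (deriv_along Y (bil_app g Z W)) =
     bil_app g (D X (D Y Z)) W + bil_app g (D Y Z) (D X W) + bil_app g (D X Z) (D Y W) + bil_app g Z (D X (D Y W))"
    if "X \<in> VF" "Y \<in> VF" for X Y
    using that V by (simp add: metric_compat deriv_along_add metric_SF D_VF add.assoc)
  have "bil_app g (D (lie_bracket X Y) Z) W + bil_app g Z (D (lie_bracket X Y) W) =
      deriv_along X (deriv_along Y (bil_app g Z W)) - deriv_along Y (deriv_along X (bil_app g Z W))"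
    using V by (simp add: metric_compat[symmetric] lie_bracket_VF deriv_along_lie_bracket)
  \<comment> \<open>The two mixed terms, in which \<open>Z\<close> and \<open>W\<close> are each
    differentiated once, are symmetric under exchange of \<open>X\<close> and \<open>Y\<close> and
    drop out.\<close>
  also have "\<dots> = bil_app g (D X (D Y Z)) W - bil_app g (D Y (D X Z)) W
      + (bil_app g Z (D X (D Y W)) - bil_app g Z (D Y (D X W)))"
    using V by (simp add: 2)
  finally show ?thesis
    using V by (simp add: curvature_def metric_diff D_VF VF_diff lie_bracket_VF metric_sym[of Z])
      (simp add: algebra_simps)
qed

text \<open>This follows from skewness in each pair of arguments together with the first Bianchi
  identity.\<close>

lemma curvature_pair_sym:
  assumes V: "X \<in> VF" "Y \<in> VF" "Z \<in> VF" "W \<in> VF"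
  shows "bil_app g (curvature D X Y Z) W = bil_app g (curvature D Z W X) Y"
proof -
  \<comment> \<open>Evaluating at a point makes every identity a linear equation between
    reals.\<close>
  define R where "R X Y Z W p = bil_app g (curvature D X Y Z) W p" for X Y Z W p
  have as: "R Y X Z W p = - R X Y Z W p" if "X \<in> VF" "Y \<in> VF" "Z \<in> VF" "W \<in> VF" for X Y Z W p
    using that by (simp add: R_def curvature_antisym[of X Y] metric_minus curvature_VF)
  have sk: "R X Y Z W p = - R X Y W Z p" if "X \<in> VF" "Y \<in> VF" "Z \<in> VF" "W \<in> VF" for X Y Z W p
    using fun_cong[OF curvature_skew[OF that], of p] by (simp add: R_def)
  have bi: "R X Y Z W p + R Y Z X W p + R Z X Y W p = 0"
    if "X \<in> VF" "Y \<in> VF" "Z \<in> VF" "W \<in> VF" for X Y Z W p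
  proof -
    have "bil_app g (curvature D X Y Z + curvature D Y Z X + curvature D Z X Y) W = 0"
      using first_bianchi[of X Y Z] that by (simp add: metric_zero)
    then have "bil_app g (curvature D X Y Z) W + bil_app g (curvature D Y Z X) W + bil_app g (curvature D Z X Y) W = 0"
      using that by (simp add: metric_add curvature_VF VF_add)
    from fun_cong[OF this, of p] show ?thesis by (simp add: R_def)
  qed
  show ?thesis
  proof
    fix p
    show "bil_app g (curvature D X Y Z) W p = bil_app g (curvature D Z W X) Y p"
      unfolding R_def[symmetric]
      \<comment> \<open>There is one Bianchi instance for each choice of last argument. Modulo the
        sign rules, adding those ending in \<open>W\<close> and \<open>X\<close> and subtracting
        those ending in \<open>Y\<close> and \<open>Z\<close> leaves twice the difference of the two
        sides.\<close>
      using bi[OF V(1) V(2) V(3) V(4), of p] bi[OF V(2) V(3) V(4) V(1), of p]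
        bi[OF V(3) V(4) V(1) V(2), of p] bi[OF V(4) V(1) V(2) V(3), of p]
        sk[OF V(2) V(3) V(4) V(1), of p] sk[OF V(3) V(4) V(2) V(1), of p] sk[OF V(1) V(4) V(3) V(2), of p]
        sk[OF V(3) V(1) V(4) V(2), of p] sk[OF V(1) V(2) V(4) V(3), of p] sk[OF V(2) V(4) V(1) V(3), of p]
        as[OF V(2) V(4) V(3) V(1), of p] as[OF V(1) V(4) V(3) V(2), of p]
        as[OF V(3) V(1) V(4) V(2), of p] as[OF V(1) V(4) V(2) V(3), of p]
      by linarith
  qed
qed

end

section \<open>The quarter-symmetric connection\<close>

locale kaehler = riemannian_manifold M g D
  for M :: "('m::{t2_space,second_countable_topology}, 'e::euclidean_space) chart set"
    and g :: "'m bilinear_form" and D :: "'m connection" +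
  fixes A :: "'m endo_field"
  assumes endo: "smooth_endo_field M A"
    and endo_square: "\<And>p u. u \<in> tangent_space M p \<Longrightarrow> A p (A p u) = - u"
    and endo_isometry: "\<And>p u v. u \<in> tangent_space M p \<Longrightarrow> v \<in> tangent_space M p \<Longrightarrow> g p (A p u) (A p v) = g p u v"
    and endo_parallel: "\<And>X Y. X \<in> VF \<Longrightarrow> Y \<in> VF \<Longrightarrow> cov_deriv_endo D A X Y = 0"
begin

section \<open>The parallel complex structure\<close>

abbreviation "J \<equiv> endo_app A"
abbreviation "R X Y Z W \<equiv> bil_app g (curvature D X Y Z) W"

lemma J_VF: "X \<in> VF \<Longrightarrow> J X \<in> VF"
  using endo by (simp add: smooth_endo_field_def)

lemma J_J: "X \<in> VF \<Longrightarrow> J (J X) = - X"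
  by (simp add: fun_eq_iff endo_app_def endo_square VF_tangent)

lemma J_add: "X \<in> VF \<Longrightarrow> Y \<in> VF \<Longrightarrow> J (X + Y) = J X + J Y"
  using endo VF_tangent[of X] VF_tangent[of Y] unfolding smooth_endo_field_def endo_app_def
  by (intro ext) simp

lemma J_scale: "X \<in> VF \<Longrightarrow> J (scale_vf f X) = scale_vf f (J X)"
  using endo VF_tangent[of X] unfolding smooth_endo_field_def endo_app_def scale_vf_def
  by (intro ext) simp

lemma J_diff: "X \<in> VF \<Longrightarrow> Y \<in> VF \<Longrightarrow> J (X - Y) = J X - J Y"
  using J_add[of "X - Y" Y] VF_diff by (simp add: algebra_simps)

lemma D_J: "X \<in> VF \<Longrightarrow> Y \<in> VF \<Longrightarrow> D X (J Y) = J (D X Y)"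
  using endo_parallel[of X Y] by (simp add: cov_deriv_endo_def)

lemma metric_J_J: "X \<in> VF \<Longrightarrow> Y \<in> VF \<Longrightarrow> bil_app g (J X) (J Y) = bil_app g X Y"
  by (auto simp: bil_app_def endo_app_def endo_isometry VF_tangent)

text \<open>An isometry with square -1 is skew: apply the isometry property to \<open>X\<close> and
  \<open>J Y\<close>.\<close>

lemma metric_J:
  assumes "X \<in> VF" "Y \<in> VF"
  shows "bil_app g X (J Y) = - bil_app g (J X) Y"
  using metric_J_J[of X "J Y"] assms
  by (simp add: J_J J_VF metric_sym[of _ "- Y"] metric_sym[of Y] metric_minus VF_minus)

text \<open>As \<open>J\<close> is parallel, it commutes with each covariant derivative and so
  passes through every term of the curvature.\<close>

lemma curvature_J: "X \<in> VF \<Longrightarrow> Y \<in> VF \<Longrightarrow> Z \<in> VF \<Longrightarrow> curvature D X Y (J Z) = J (curvature D X Y Z)"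
  by (simp add: curvature_def D_J D_VF J_diff VF_diff lie_bracket_VF)

text \<open>By pair symmetry, \<open>J\<close>-invariance in the last two slots carries over to the first two.\<close>

lemma curvature_J_J:
  assumes V: "X \<in> VF" "Y \<in> VF" "Z \<in> VF" "W \<in> VF"
  shows "R (J X) (J Y) Z W = R X Y Z W"
proof -
  have "R (J X) (J Y) Z W = R Z W (J X) (J Y)"
    using V by (simp add: curvature_pair_sym[of "J X"] J_VF)
  also have "\<dots> = R Z W X Y"
    using V by (simp add: curvature_J metric_J_J curvature_VF)
  finally show ?thesis
    using V by (simp add: curvature_pair_sym[of Z])
qed

section \<open>The generating one-form and the curvature of the first kind\<close>

context
  fixes \<pi> :: "'m one_form"
  assumes form: "smooth_one_form M \<pi>"
begin

lemma form_SF: "X \<in> VF \<Longrightarrow> form_app \<pi> X \<in> SF"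
  using form by (simp add: smooth_one_form_def)

lemma form_add: "X \<in> VF \<Longrightarrow> Y \<in> VF \<Longrightarrow> form_app \<pi> (X + Y) = form_app \<pi> X + form_app \<pi> Y"
  using form VF_tangent[of X] VF_tangent[of Y] unfolding smooth_one_form_def form_app_def
  by (intro ext) simp

lemma form_diff: "X \<in> VF \<Longrightarrow> Y \<in> VF \<Longrightarrow> form_app \<pi> (X - Y) = form_app \<pi> X - form_app \<pi> Y"
  using form_add[of "X - Y" Y] VF_diff by (simp add: algebra_simps)

lemma form_minus: "X \<in> VF \<Longrightarrow> form_app \<pi> (- X) = - form_app \<pi> X"
  using form_diff[of X X] form_diff[of "X - X" X] VF_zero by simp

abbreviation "N \<equiv> cov_deriv_form D \<pi>"
abbreviation "d\<pi> X Y \<equiv> N X Y - N Y X"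

text \<open>Vanishing torsion identifies the alternation of \<open>N\<close> with the exterior
  derivative of \<pi>. In this form it can be recognised in the curvature computation.\<close>

lemma exterior_derivative:
  "X \<in> VF \<Longrightarrow> Y \<in> VF \<Longrightarrow>
    d\<pi> X Y = deriv_along X (form_app \<pi> Y) - deriv_along Y (form_app \<pi> X) - form_app \<pi> (lie_bracket X Y)"
  by (simp add: cov_deriv_form_def lie_bracket_eq form_diff D_VF algebra_simps)

lemma curvature1_eq:
  assumes V: "X \<in> VF" "Y \<in> VF" "Z \<in> VF"
  shows "curvature1 D A \<pi> X Y Z = curvature D X Y Z - scale_vf (d\<pi> X Y) (J Z)"
proof -
  let ?Q = "quarter_symmetric_connection D A \<pi>"
  \<comment> \<open>The last term carries a minus sign because \<open>J (J Z) = - Z\<close>. It is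
    symmetric in \<open>X\<close> and \<open>Y\<close>, and so is the sum of the two terms with one
    derivative of \<open>Z\<close> under \<open>J\<close>; neither survives the alternation.\<close>
  have QQ: "?Q X (?Q Y Z) = D X (D Y Z)
      - scale_vf (deriv_along X (form_app \<pi> Y)) (J Z) - scale_vf (form_app \<pi> Y) (J (D X Z))
      - scale_vf (form_app \<pi> X) (J (D Y Z)) - scale_vf (form_app \<pi> X) (scale_vf (form_app \<pi> Y) Z)"
    if "X \<in> VF" "Y \<in> VF" for X Y
    using that V
    by (simp add: quarter_symmetric_connection_def D_diff D_VF VF_scale form_SF J_VF D_scale D_J
      J_diff J_scale J_J scale_vf_diff scale_vf_add scale_vf_minus)
  show ?thesis
    unfolding curvature1_def curvature_def exterior_derivative[OF V(1,2)] scale_vf_diff_left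
    \<comment> \<open>The bracket term contributes \<pi>\<open>([X,Y]) J Z\<close>, which completes
      the two derivatives of \<pi> to \<open>d\<pi>\<close>. Commuting the scalars then exposes the
      cancellation of the quadratic terms.\<close>
    by (simp only: QQ V quarter_symmetric_connection_def[of D A \<pi> "lie_bracket X Y"])
      (simp add: scale_vf_commute[of "form_app \<pi> Y"] algebra_simps)
qed

lemma curvature1_VF: "X \<in> VF \<Longrightarrow> Y \<in> VF \<Longrightarrow> Z \<in> VF \<Longrightarrow> curvature1 D A \<pi> X Y Z \<in> VF"
  by (simp add: curvature1_eq cov_deriv_form_def curvature_VF J_VF VF_diff VF_scale smooth_diff
    VF_deriv form_SF D_VF)

text \<open>Both summands commute with \<open>J\<close>: the Riemannian curvature because
  \<open>J\<close> is parallel, the other because it is a function multiple of \<open>J\<close>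
  itself.\<close>

lemma curvature1_J:
  "X \<in> VF \<Longrightarrow> Y \<in> VF \<Longrightarrow> Z \<in> VF \<Longrightarrow> curvature1 D A \<pi> X Y (J Z) = J (curvature1 D A \<pi> X Y Z)"
  by (simp add: curvature1_eq curvature_J J_diff J_scale J_VF VF_scale curvature_VF
    cov_deriv_form_def smooth_diff VF_deriv form_SF D_VF)

abbreviation "R1 \<equiv> curvature1_low g D A \<pi>"

lemma curvature1_low_J:
  "X \<in> VF \<Longrightarrow> Y \<in> VF \<Longrightarrow> Z \<in> VF \<Longrightarrow> W \<in> VF \<Longrightarrow> R1 X Y Z (J W) = - R1 X Y (J Z) W"
  by (simp add: curvature1_low_def curvature1_J metric_J curvature1_VF)

text \<open>Commutation with \<open>J\<close> reduces this to the isometry property. Together with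
  invariance in the first two arguments it yields the first and third identities of part
  (1).\<close>

lemma curvature1_low_J_right:
  "X \<in> VF \<Longrightarrow> Y \<in> VF \<Longrightarrow> Z \<in> VF \<Longrightarrow> W \<in> VF \<Longrightarrow> R1 X Y (J Z) (J W) = R1 X Y Z W"
  by (simp add: curvature1_low_def curvature1_J metric_J_J curvature1_VF)

lemma curvature1_low_eq:
  "X \<in> VF \<Longrightarrow> Y \<in> VF \<Longrightarrow> Z \<in> VF \<Longrightarrow> W \<in> VF \<Longrightarrow>
    R1 X Y Z W = R X Y Z W - d\<pi> X Y * bil_app g (J Z) W"
  by (simp add: curvature1_low_def curvature1_eq metric_diff metric_scale curvature_VF J_VF VF_scale
    cov_deriv_form_def smooth_diff VF_deriv form_SF D_VF)

text \<open>The mixed identity below produces \<open>J (J Y) = - Y\<close> in the second argument,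
  and this rule extracts the sign.\<close>

lemma curvature1_low_minus:
  assumes "X \<in> VF" "Y \<in> VF" "Z \<in> VF" "W \<in> VF"
  shows "R1 X (- Y) Z W = - R1 X Y Z W"
proof -
  have m: "D (- Y) U = - D Y U" "D U (- Y) = - D U Y" if "U \<in> VF" for U
    using that assms D_minus_left D_minus by auto
  have "lie_bracket X (- Y) = - lie_bracket X Y"
    using assms by (simp add: lie_bracket_eq VF_minus m)
  then have "curvature D X (- Y) Z = - curvature D X Y Z"
    using assms by (simp add: curvature_def m D_VF D_minus D_minus_left lie_bracket_VF)
  moreover have "N X (- Y) = - N X Y" "N (- Y) X = - N Y X"
    using assms
    by (simp_all add: cov_deriv_form_def m D_VF form_minus deriv_along_minus deriv_along_minus_left form_SF)
  ultimately show ?thesis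
    using assms by (simp add: curvature1_low_eq VF_minus metric_minus curvature_VF algebra_simps)
qed

text \<open>The Riemannian part is invariant by \<open>curvature_J_J\<close>. For
  \<open>d\<pi>\<close> it is enough that \<open>N\<close> is invariant, which is hybridity combined
  with \<open>J\<close> having square -1.\<close>

lemma curvature1_low_J_left:
  assumes H: "hybrid M A N" and V: "X \<in> VF" "Y \<in> VF" "Z \<in> VF" "W \<in> VF"
  shows "R1 (J X) (J Y) Z W = R1 X Y Z W"
proof -
  have "N (J X) (J Y) = N X Y" if "X \<in> VF" "Y \<in> VF" for X Y
  proof -
    \<comment> \<open>Hybridity is taken at \<open>J X\<close> and \<open>Y\<close>, so that the
      double \<open>J\<close> on the left contributes the compensating sign.\<close>
    have "N (J (J X)) Y = - N (J X) (J Y)"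
      using H that J_VF by (simp add: hybrid_def)
    moreover have "N (- X) Y = - N X Y"
      using that by (simp add: cov_deriv_form_def D_minus_left D_VF form_minus deriv_along_minus_left)
    ultimately show ?thesis using that by (simp add: J_J)
  qed
  then show ?thesis using V by (simp add: curvature1_low_eq J_VF curvature_J_J)
qed

text \<open>Applying \<open>J\<close> to the first two arguments turns \<open>J Y\<close> into
  \<open>- Y\<close>; moving \<open>J\<close> from the third to the fourth argument costs a second
  sign, and the two cancel.\<close>

lemma curvature1_low_J_mixed:
  assumes H: "hybrid M A N" and V: "X \<in> VF" "Y \<in> VF" "Z \<in> VF" "W \<in> VF"
  shows "R1 X (J Y) (J Z) W = R1 (J X) Y Z (J W)"
proof -
  have "R1 X (J Y) (J Z) W = R1 (J X) (J (J Y)) (J Z) W"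
    using V by (simp add: curvature1_low_J_left[OF H] J_VF)
  also have "\<dots> = - R1 (J X) Y (J Z) W"
    using V by (simp add: J_J curvature1_low_minus J_VF)
  finally show ?thesis using V by (simp add: curvature1_low_J J_VF)
qed

end

end

theorem theorem4p2:
  fixes M :: "('m::{t2_space,second_countable_topology}, 'e::euclidean_space) chart set"
    and g :: "'m bilinear_form" and A :: "'m endo_field"
    and D :: "'m connection" and \<pi> :: "'m one_form"
  defines "J \<equiv> endo_app A"
    and "R1 \<equiv> curvature1 D A \<pi>"
    and "R1g \<equiv> curvature1_low g D A \<pi>"
  assumes "kaehler_manifold M g A D"
    and "smooth_one_form M \<pi>"
  shows "(hybrid M A (cov_deriv_form D \<pi>) \<longrightarrow>
      (\<forall>X\<in>vector_fields M. \<forall>Y\<in>vector_fields M. \<forall>Z\<in>vector_fields M. \<forall>W\<in>vector_fields M.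
         R1g X Y (J Z) (J W) = R1g (J X) (J Y) Z W \<and>
         R1g X (J Y) (J Z) W = R1g (J X) Y Z (J W) \<and>
         R1g (J X) (J Y) (J Z) (J W) = R1g X Y Z W)) \<and>
    (\<forall>X\<in>vector_fields M. \<forall>Y\<in>vector_fields M. \<forall>Z\<in>vector_fields M. \<forall>W\<in>vector_fields M.
       R1 X Y (J Z) = J (R1 X Y Z) \<and>
       R1g X Y Z (J W) = - R1g X Y (J Z) W)"
proof -
  interpret K: kaehler M g D A
    using assms(4) by unfold_locales (auto simp: kaehler_manifold_def)
  note form = \<open>smooth_one_form M \<pi>\<close>
  show ?thesis
    unfolding J_def R1_def R1g_def
    \<comment> \<open>The mixed identity and both claims of part (2) are instances of earlier
      lemmas. In the other two identities simplification removes each pair of \<open>J\<close>, from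
      the first two or the last two arguments, until the sides agree.\<close>
    by (intro conjI impI ballI;
        ((rule K.curvature1_low_J_mixed[OF form] K.curvature1_J[OF form] K.curvature1_low_J[OF form]; assumption)
          | simp add: K.curvature1_low_J_left[OF form] K.curvature1_low_J_right[OF form] K.J_VF))
qed

end
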